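(* Let $\alpha>-\frac12$, $a>0$ and $f\in\mathcal{D}_a(\mathbb{R})$. Then for every $n\in\mathbb{N}$, the $n$-th derivative $[\mathcal{F}_{B,S}^\alpha(f)]^{(n)}$ belongs to $C_0(\mathbb{R})$.
   Context: $\mathcal{D}_a(\mathbb{R})$ is the space of infinitely differentiable (complex-valued) functions on $\mathbb{R}$ with support in $[-a,a]$. $C_0(\mathbb{R})$ is the space of continuous functions on $\mathbb{R}$ tending to $0$ at infinity. For $\alpha>-\frac12$, the Bessel-Struve kernel is $S_\lambda^\alpha(x)=\frac{2\Gamma(\alpha+1)}{\sqrt\pi\,\Gamma(\alpha+\frac12)}\int_0^1(1-t^2)^{\alpha-\frac12}e^{\lambda xt}\,dt$ and the Bessel-Struve transform is $\mathcal{F}_{B,S}^\alpha(f)(\lambda)=\int_{\mathbb{R}}f(x)\,S_{-i\lambda}^\alpha(x)\,|x|^{2\alpha+1}dx$, $\lambda\in\mathbb{R}$. *)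

theory Defs
  imports "HOL-Analysis.Analysis"
begin

text \<open>Higher derivatives of a complex-valued function of a real variable. As
  \<^const>\<open>vector_derivative\<close> is total, the value \<open>nth_deriv n g\<close> is meaningful only if
  \<open>times_differentiable n g\<close> holds.\<close>

definition nth_deriv :: "nat \<Rightarrow> (real \<Rightarrow> complex) \<Rightarrow> real \<Rightarrow> complex" where
  "nth_deriv n g = ((\<lambda>h x. vector_derivative h (at x)) ^^ n) g"

definition times_differentiable :: "nat \<Rightarrow> (real \<Rightarrow> complex) \<Rightarrow> bool" where
  "times_differentiable n g \<longleftrightarrow> (\<forall>k<n. nth_deriv k g differentiable_on UNIV)"

definition test_functions :: "real \<Rightarrow> (real \<Rightarrow> complex) set" where
  "test_functions a =
    {f. (\<forall>n. times_differentiable n f) \<and> closure (support_on UNIV f) \<subseteq> {-a..a}}"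

definition C_zero :: "(real \<Rightarrow> complex) set" where
  "C_zero = {g. continuous_on UNIV g \<and> (g \<longlongrightarrow> 0) at_infinity}"

text \<open>For \<open>\<alpha> < 1/2\<close> the weight \<open>(1 - t\<^sup>2) powr (\<alpha> - 1/2)\<close> is singular at \<open>t = 1\<close>; there
  the convention \<open>0 powr _ = 0\<close> affects only a null set.\<close>

definition bessel_struve_kernel :: "real \<Rightarrow> complex \<Rightarrow> real \<Rightarrow> complex" where
  "bessel_struve_kernel \<alpha> z x =
    of_real (2 * Gamma (\<alpha> + 1) / (sqrt pi * Gamma (\<alpha> + 1/2))) *
    (LINT t:{0..1}|lborel. of_real ((1 - t\<^sup>2) powr (\<alpha> - 1/2)) * exp (z * of_real x * of_real t))"

definition bessel_struve_transform :: "real \<Rightarrow> (real \<Rightarrow> complex) \<Rightarrow> real \<Rightarrow> complex" where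
  "bessel_struve_transform \<alpha> f \<xi> =
    (LINT x|lborel. f x * bessel_struve_kernel \<alpha> (- \<i> * of_real \<xi>) x *
      of_real (\<bar>x\<bar> powr (2 * \<alpha> + 1)))"

end

theory Submission
  imports Defs
begin

text \<open>By Fubini, the transform of \<open>f\<close> is an average over the dilations \<open>t \<in> {0..1}\<close>, with
  integrable weight \<open>W t = c (1 - t\<^sup>2) powr (\<alpha> - 1/2)\<close>, of the values at \<open>\<xi> t\<close> of the
  Fourier transform of the continuous, compactly supported function
  \<open>g x = f x \<bar>x\<bar> powr (2\<alpha> + 1)\<close>. Each derivative in \<open>\<xi>\<close> multiplies the weight by \<open>t\<close> and
  \<open>g\<close> by \<open>- \<i> x\<close>, so all derivatives are averages of the same form. The Riemann-Lebesgue
  lemma shows that the integrand of such an average tends to \<open>0\<close> for every \<open>t \<noteq> 0\<close>, and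
  dominated convergence concludes.\<close>

section \<open>Limits along sequences and differentiation under the integral sign\<close>

text \<open>Brings limits at infinity into the form in which dominated convergence applies. On the
  real line \<open>at_infinity\<close> is the supremum of \<open>at_top\<close> and
  \<open>at_bot\<close>, and sequences detect convergence along each of these.\<close>

lemma tendsto_at_infinityI_sequentially:
  fixes f :: "real \<Rightarrow> 'b::first_countable_topology"
  assumes "\<And>X. filterlim X at_infinity sequentially \<Longrightarrow> (\<lambda>n. f (X n)) \<longlonglongrightarrow> y"
  shows "(f \<longlongrightarrow> y) at_infinity"
  unfolding at_infinity_eq_at_top_bot
  by (intro filterlim_sup tendsto_at_topI_sequentially tendsto_at_botI_sequentially assms)
    (auto intro: filterlim_at_top_imp_at_infinity filterlim_at_bot_imp_at_infinity)

text \<open>Dominated convergence applied to the first-order remainder quotient along sequences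
  tending to \<open>s\<close>. As \<open>B\<close> bounds the derivative at every parameter, the
  mean value inequality turns it into a majorant of all these quotients.\<close>

lemma has_vector_derivative_lebesgue_integral:
  fixes F F' :: "real \<Rightarrow> 'a \<Rightarrow> 'b::{banach, second_countable_topology}"
  assumes F: "\<And>s. integrable M (F s)"
    and F': "F' s \<in> borel_measurable M"
    and B: "integrable M B"
    and deriv: "\<And>s y. y \<in> space M \<Longrightarrow> ((\<lambda>s. F s y) has_vector_derivative F' s y) (at s)"
    and bound: "\<And>s y. y \<in> space M \<Longrightarrow> norm (F' s y) \<le> B y"
  shows "((\<lambda>s. \<integral>y. F s y \<partial>M) has_vector_derivative (\<integral>y. F' s y \<partial>M)) (at s)"
proof -
  have F'_int: "integrable M (F' s)"
    by (rule Bochner_Integration.integrable_bound[OF B F'])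
      (intro AE_I2 order_trans[OF bound], auto)
  \<comment> \<open>This is the quotient whose limit \<open>0\<close> at \<open>s\<close> defines
    differentiability of \<open>F\<close> in its parameter. Since it is linear in the values of
    \<open>F\<close> and \<open>F'\<close>, its integral is the same quotient for the integrated
    function.\<close>
  define q where "q u y = (1 / norm (u - s)) *\<^sub>R (F u y - (F s y + (u - s) *\<^sub>R F' s y))" for u y
  have q_meas: "q u \<in> borel_measurable M" for u
    unfolding q_def using F[of u] F[of s] F' by (auto dest!: borel_measurable_integrable)
  have int_q: "(\<integral>y. q u y \<partial>M) =
      (1 / norm (u - s)) *\<^sub>R ((\<integral>y. F u y \<partial>M) - ((\<integral>y. F s y \<partial>M) + (u - s) *\<^sub>R (\<integral>y. F' s y \<partial>M)))" for u
    unfolding q_def using F F'_int by simp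
  have q_bound: "norm (q u y) \<le> 2 * B y" if y: "y \<in> space M" and "u \<noteq> s" for u y
  proof -
    \<comment> \<open>Mean value inequality; together with the linear term, also at most
      \<open>B y * norm (u - s)\<close>, it yields the factor 2.\<close>
    have "norm (F u y - F s y) \<le> B y * norm (u - s)"
    proof (rule differentiable_bound[of UNIV "\<lambda>u. F u y" "\<lambda>u h. h *\<^sub>R F' u y"])
      show "((\<lambda>u. F u y) has_derivative (\<lambda>h. h *\<^sub>R F' x y)) (at x)" for x
        using deriv[OF y] by (simp add: has_vector_derivative_def)
      show "onorm (\<lambda>h. h *\<^sub>R F' x y) \<le> B y" for x
      proof (rule onorm_le)
        show "norm (h *\<^sub>R F' x y) \<le> B y * norm h" for h
          using mult_right_mono[OF bound[OF y, of x], of "norm h"] by (simp add: mult.commute)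
      qed
    qed auto
    moreover have "norm ((u - s) *\<^sub>R F' s y) \<le> norm (u - s) * B y"
      using bound[OF y, of s] by (simp add: mult_left_mono)
    ultimately have "norm (F u y - F s y - (u - s) *\<^sub>R F' s y) \<le> norm (u - s) * (2 * B y)"
      by (intro order_trans[OF norm_triangle_ineq4]) (simp add: algebra_simps)
    then show ?thesis
      using \<open>u \<noteq> s\<close> by (simp add: q_def diff_diff_eq divide_le_eq mult.commute)
  qed
  have "((\<lambda>u. \<integral>y. q u y \<partial>M) \<longlongrightarrow> 0) (at s)"
    unfolding tendsto_at_iff_sequentially comp_def
  proof (intro allI impI)
    fix X :: "nat \<Rightarrow> real"
    assume X: "\<forall>i. X i \<in> UNIV - {s}" "X \<longlonglongrightarrow> s"
    have "(\<lambda>i. \<integral>y. q (X i) y \<partial>M) \<longlonglongrightarrow> (\<integral>y. 0 \<partial>M)"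
    proof (rule integral_dominated_convergence)
      show "integrable M (\<lambda>y. 2 * B y)" using B by simp
      show "AE y in M. (\<lambda>i. q (X i) y) \<longlonglongrightarrow> 0"
      proof (rule AE_I2)
        fix y assume "y \<in> space M"
        from deriv[OF this, of s] have "((\<lambda>u. q u y) \<longlongrightarrow> 0) (at s)"
          by (simp add: has_vector_derivative_def has_derivative_within q_def)
        then show "(\<lambda>i. q (X i) y) \<longlonglongrightarrow> 0"
          using X unfolding tendsto_at_iff_sequentially comp_def by blast
      qed
      show "AE y in M. norm (q (X i) y) \<le> 2 * B y" for i
        using q_bound X(1) by auto
    qed (use q_meas in auto)
    then show "(\<lambda>i. \<integral>y. q (X i) y \<partial>M) \<longlonglongrightarrow> 0" by simp
  qed
  then show ?thesis
    by (simp add: has_vector_derivative_def has_derivative_within int_q bounded_linear_scaleR_left)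
qed

section \<open>The Fourier transform: differentiation and the Riemann-Lebesgue lemma\<close>

definition fourier :: "(real \<Rightarrow> complex) \<Rightarrow> real \<Rightarrow> complex" where
  "fourier g \<xi> = (LINT x|lborel. g x * cis (- (\<xi> * x)))"

lemma integrable_compact_support:
  fixes g :: "real \<Rightarrow> 'a::{banach, second_countable_topology}"
  assumes "continuous_on UNIV g" "\<forall>x. x \<notin> {-a..a} \<longrightarrow> g x = 0"
  shows "integrable lborel g"
proof -
  have "integrable lborel (\<lambda>x. indicator {-a..a} x *\<^sub>R g x)"
    by (intro borel_integrable_compact continuous_on_subset[OF assms(1)]) auto
  also have "(\<lambda>x. indicator {-a..a} x *\<^sub>R g x) = g"
    using assms(2) by (fastforce simp: indicator_def)
  finally show ?thesis .
qed

lemma integrable_mult_cis: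
  assumes "integrable M g" "h \<in> borel_measurable M"
  shows "integrable M (\<lambda>x. g x * cis (h x))"
proof (rule Bochner_Integration.integrable_bound[OF assms(1)])
  have "continuous_on UNIV cis" by (intro continuous_intros)
  then have "cis \<in> borel_measurable borel" by (rule borel_measurable_continuous_onI)
  from measurable_compose[OF assms(2) this]
  show "(\<lambda>x. g x * cis (h x)) \<in> borel_measurable M"
    using assms(1) by (auto dest: borel_measurable_integrable)
qed (simp add: norm_mult)

lemma norm_fourier_le: "norm (fourier g \<xi>) \<le> (LINT x|lborel. norm (g x))"
  unfolding fourier_def
  by (rule order_trans[OF integral_norm_bound]) (simp add: norm_mult)

lemma has_vector_derivative_cis_mult:
  "((\<lambda>s. c * cis (- (s * x))) has_vector_derivative (- \<i> * of_real x * c) * cis (- (s * x))) (at s)"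
  unfolding has_vector_derivative_def
  by (rule derivative_eq_intros refl)+ (auto simp: scaleR_conv_of_real algebra_simps)

text \<open>Since \<open>cis\<close> has modulus 1, the differentiated integrand is bounded by the
  modulus of \<open>x * g x\<close>, uniformly in the frequency.\<close>

lemma has_vector_derivative_fourier:
  assumes "integrable lborel g" "integrable lborel (\<lambda>x. of_real x * g x)"
  shows "(fourier g has_vector_derivative fourier (\<lambda>x. - \<i> * of_real x * g x) \<xi>) (at \<xi>)"
  unfolding fourier_def
proof (rule has_vector_derivative_lebesgue_integral[where B = "\<lambda>x. norm (of_real x * g x)"])
  have "integrable lborel (\<lambda>x. - \<i> * (of_real x * g x))"
    using assms(2) by (intro integrable_mult_right)
  then have "integrable lborel (\<lambda>x. - \<i> * of_real x * g x * cis (- (\<xi> * x)))"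
    by (intro integrable_mult_cis) (auto simp: mult.assoc)
  then show "(\<lambda>x. - \<i> * of_real x * g x * cis (- (\<xi> * x))) \<in> borel_measurable lborel"
    by (rule borel_measurable_integrable)
  show "integrable lborel (\<lambda>x. norm (of_real x * g x))"
    using assms(2) by (rule integrable_norm)
  show "((\<lambda>\<xi>. g x * cis (- (\<xi> * x))) has_vector_derivative
      - \<i> * of_real x * g x * cis (- (\<xi> * x))) (at \<xi>)" for \<xi> x
    by (rule has_vector_derivative_cis_mult)
qed (use assms in \<open>auto intro!: integrable_mult_cis simp: norm_mult\<close>)

text \<open>Translating by \<open>\<pi> / \<xi>\<close> changes the sign of \<open>cis (- \<xi> x)\<close>.\<close>

lemma fourier_shift:
  assumes "integrable lborel g" "\<xi> \<noteq> 0"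
  shows "2 * fourier g \<xi> = fourier (\<lambda>x. g x - g (x + pi / \<xi>)) \<xi>"
proof -
  have cis: "cis (- (\<xi> * (x + pi / \<xi>))) = - cis (- (\<xi> * x))" for x
  proof -
    have "- (\<xi> * (x + pi / \<xi>)) = - pi + - (\<xi> * x)"
      using assms(2) by (simp add: algebra_simps)
    then show ?thesis
      by (simp only: cis_mult[symmetric]) (simp add: cis_cnj[symmetric])
  qed
  have int: "integrable lborel (\<lambda>x. g (x + pi / \<xi>))"
    using lborel_integrable_real_affine[OF assms(1), of 1 "pi / \<xi>"] by (simp add: add.commute)
  have "fourier g \<xi> = - fourier (\<lambda>x. g (x + pi / \<xi>)) \<xi>"
    unfolding fourier_def
    by (subst lborel_integral_real_affine[where c = 1 and t = "pi / \<xi>"])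
      (simp_all add: add.commute[of "pi / \<xi>"] cis)
  moreover have "fourier (\<lambda>x. g x - g (x + pi / \<xi>)) \<xi> = fourier g \<xi> - fourier (\<lambda>x. g (x + pi / \<xi>)) \<xi>"
    unfolding fourier_def left_diff_distrib using assms(1) int
    by (intro Bochner_Integration.integral_diff integrable_mult_cis) auto
  ultimately show ?thesis by simp
qed

text \<open>Riemann-Lebesgue by translation: \<open>fourier_shift\<close> bounds twice the modulus
  of the transform by the L1 distance from \<open>g\<close> to its translate by
  \<open>pi / \<xi>\<close>. That distance tends to 0, by continuity of \<open>g\<close> and
  dominated convergence.\<close>

lemma fourier_tendsto_0:
  assumes cont: "continuous_on UNIV g" and supp: "\<forall>x. x \<notin> {-a..a} \<longrightarrow> g x = 0"
  shows "(fourier g \<longlongrightarrow> 0) at_infinity"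
proof (rule tendsto_at_infinityI_sequentially)
  fix X :: "nat \<Rightarrow> real"
  assume X: "filterlim X at_infinity sequentially"
  have int: "integrable lborel g"
    using integrable_compact_support[OF cont supp] .
  have "bounded (g ` {-a..a})"
    by (intro compact_imp_bounded compact_continuous_image continuous_on_subset[OF cont]) auto
  then obtain K where K: "K > 0" "\<And>x. x \<in> {-a..a} \<Longrightarrow> norm (g x) \<le> K"
    by (auto simp: bounded_pos)
  have gK: "norm (g x) \<le> K" for x
    using K supp by (cases "x \<in> {-a..a}") auto
  have h: "(\<lambda>n. pi / X n) \<longlonglongrightarrow> 0"
    by (rule tendsto_divide_0[OF tendsto_const X])
  \<comment> \<open>A common bound on the shifts puts the supports of all differences
    \<open>g x - g (x + pi / X n)\<close> into the single interval \<open>{-(a+H)..a+H}\<close>,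
    where \<open>2 * K\<close> bounds them.\<close>
  obtain H where H: "\<And>n. norm (pi / X n) \<le> H"
    using convergent_imp_Bseq[OF convergentI[OF h]] by (auto simp: Bseq_def)
  have "(\<lambda>n. LINT x|lborel. norm (g x - g (x + pi / X n))) \<longlonglongrightarrow> (LINT x|(lborel::real measure). 0)"
  proof (rule integral_dominated_convergence)
    show "integrable lborel (\<lambda>x. indicator {-(a+H)..a+H} x *\<^sub>R (2 * K))"
      by (intro borel_integrable_compact) auto
    have [measurable]: "g \<in> borel_measurable borel"
      using cont by (rule borel_measurable_continuous_onI)
    show "(\<lambda>x. norm (g x - g (x + pi / X n))) \<in> borel_measurable lborel" for n
      by measurable
    show "AE x in lborel. (\<lambda>n. norm (g x - g (x + pi / X n))) \<longlonglongrightarrow> 0"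
    proof (rule AE_I2)
      fix x
      have "(\<lambda>n. g (x + pi / X n)) \<longlonglongrightarrow> g (x + 0)"
        using cont by (intro isCont_tendsto_compose[where g = g] tendsto_intros h)
          (auto simp: continuous_on_eq_continuous_at)
      then have "(\<lambda>n. norm (g x - g (x + pi / X n))) \<longlonglongrightarrow> norm (g x - g (x + 0))"
        by (intro tendsto_intros)
      then show "(\<lambda>n. norm (g x - g (x + pi / X n))) \<longlonglongrightarrow> 0" by simp
    qed
    show "AE x in lborel. norm (norm (g x - g (x + pi / X n)))
        \<le> indicator {-(a+H)..a+H} x *\<^sub>R (2 * K)" for n
    proof (rule AE_I2)
      fix x
      show "norm (norm (g x - g (x + pi / X n))) \<le> indicator {-(a+H)..a+H} x *\<^sub>R (2 * K)"
      proof (cases "x \<in> {-(a+H)..a+H}")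
        case True
        then show ?thesis
          using norm_triangle_ineq4[of "g x" "g (x + pi / X n)"] gK[of x] gK[of "x + pi / X n"] by simp
      next
        case False
        have "pi / X n \<le> H" "- (pi / X n) \<le> H"
          using H[of n] by (simp_all only: real_norm_def abs_le_iff)
        then have "x \<notin> {-a..a}" "x + pi / X n \<notin> {-a..a}"
          using False unfolding atLeastAtMost_iff by linarith+
        then show ?thesis using K(1) by (simp add: supp)
      qed
    qed
  qed auto
  then have lim: "(\<lambda>n. LINT x|lborel. norm (g x - g (x + pi / X n))) \<longlonglongrightarrow> 0" by simp
  have "(\<lambda>n. 2 * fourier g (X n)) \<longlonglongrightarrow> 0"
  proof (rule Lim_null_comparison[OF _ lim])
    \<comment> \<open>\<open>fourier_shift\<close> requires a nonzero frequency, which the sequence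
      guarantees only from some index on.\<close>
    have "eventually (\<lambda>n. X n \<noteq> 0) sequentially"
      using X by (rule filterlim_at_infinity_imp_eventually_ne)
    then show "\<forall>\<^sub>F n in sequentially. norm (2 * fourier g (X n))
        \<le> (LINT x|lborel. norm (g x - g (x + pi / X n)))"
      by eventually_elim (subst fourier_shift[OF int], assumption, rule norm_fourier_le)
  qed
  then have "(\<lambda>n. (1/2) * (2 * fourier g (X n))) \<longlonglongrightarrow> (1/2) * 0"
    by (intro tendsto_intros)
  then show "(\<lambda>n. fourier g (X n)) \<longlonglongrightarrow> 0" by simp
qed

section \<open>Averages of a Fourier transform over dilations\<close>

definition averaged_fourier :: "(real \<Rightarrow> real) \<Rightarrow> (real \<Rightarrow> complex) \<Rightarrow> real \<Rightarrow> complex" where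
  "averaged_fourier W g \<xi> = (LINT t|lborel. of_real (W t) * fourier g (\<xi> * t))"

lemma has_vector_derivative_fourier_compact:
  assumes cont: "continuous_on UNIV g" and supp: "\<forall>x. x \<notin> {-a..a} \<longrightarrow> g x = 0"
  shows "(fourier g has_vector_derivative fourier (\<lambda>x. - \<i> * of_real x * g x) \<xi>) (at \<xi>)"
  by (intro has_vector_derivative_fourier integrable_compact_support[of _ a] continuous_intros
      cont supp) (auto simp: supp)

lemma borel_measurable_fourier:
  assumes "continuous_on UNIV g" "\<forall>x. x \<notin> {-a..a} \<longrightarrow> g x = 0"
  shows "fourier g \<in> borel_measurable borel"
  by (intro borel_measurable_continuous_onI continuous_at_imp_continuous_on ballI
      has_vector_derivative_continuous[OF has_vector_derivative_fourier_compact[OF assms]])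

text \<open>The transform is bounded by the L1 norm of \<open>g\<close>, so a constant multiple of
  \<open>W\<close> dominates the integrand.\<close>

lemma integrable_averaged:
  assumes W: "integrable lborel W"
    and cont: "continuous_on UNIV g" and supp: "\<forall>x. x \<notin> {-a..a} \<longrightarrow> g x = 0"
  shows "integrable lborel (\<lambda>t. of_real (W t) * fourier g (\<xi> * t))"
proof (rule Bochner_Integration.integrable_bound)
  show "integrable lborel (\<lambda>t. W t * (LINT x|lborel. norm (g x)))"
    using W by simp
  have [measurable]: "W \<in> borel_measurable borel"
    using W by auto
  note borel_measurable_fourier[OF cont supp, measurable]
  show "(\<lambda>t. of_real (W t) * fourier g (\<xi> * t)) \<in> borel_measurable lborel"
    by measurable
qed (auto simp: norm_mult abs_mult intro!: mult_left_mono order_trans[OF norm_fourier_le])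

lemma averaged_fourier_tendsto_0:
  assumes W: "integrable lborel W"
    and cont: "continuous_on UNIV g" and supp: "\<forall>x. x \<notin> {-a..a} \<longrightarrow> g x = 0"
  shows "(averaged_fourier W g \<longlongrightarrow> 0) at_infinity"
proof (rule tendsto_at_infinityI_sequentially)
  fix X :: "nat \<Rightarrow> real"
  assume X: "filterlim X at_infinity sequentially"
  have "(\<lambda>n. averaged_fourier W g (X n)) \<longlonglongrightarrow> (LINT t|(lborel::real measure). 0)"
    unfolding averaged_fourier_def
  proof (rule integral_dominated_convergence)
    show "integrable lborel (\<lambda>t. \<bar>W t\<bar> * (LINT x|lborel. norm (g x)))"
      using W by simp
    show "AE t in lborel. (\<lambda>n. of_real (W t) * fourier g (X n * t)) \<longlonglongrightarrow> 0"
      \<comment> \<open>For \<open>t = 0\<close> the frequency \<open>X n * t\<close> stays at 0 and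
        the transform need not tend to 0; this point is a null set.\<close>
      using AE_lborel_singleton[of 0]
    proof eventually_elim
      case (elim t)
      have "filterlim (\<lambda>n. t * X n) at_infinity sequentially"
        using elim by (intro tendsto_mult_filterlim_at_infinity[OF tendsto_const _ X, of t]) auto
      then have "(\<lambda>n. fourier g (t * X n)) \<longlonglongrightarrow> 0"
        by (rule filterlim_compose[OF fourier_tendsto_0[OF cont supp]])
      then show ?case by (intro tendsto_mult_right_zero) (simp add: mult.commute)
    qed
    show "(\<lambda>t. of_real (W t) * fourier g (X n * t)) \<in> borel_measurable lborel" for n
      using integrable_averaged[OF W cont supp] by (rule borel_measurable_integrable)
  qed (auto simp: norm_mult intro!: mult_left_mono norm_fourier_le)
  then show "(\<lambda>n. averaged_fourier W g (X n)) \<longlonglongrightarrow> 0" by simp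
qed

text \<open>The chain rule for the dilation by \<open>t\<close> produces the factor
  \<open>t\<close>, absorbed into the weight; differentiating the transform produces
  \<open>- \<i> * x\<close>, absorbed into \<open>g\<close>. The result is again an average, so the
  rule can be iterated.\<close>

lemma averaged_fourier_deriv:
  assumes W: "integrable lborel W" "integrable lborel (\<lambda>t. t * W t)"
    and cont: "continuous_on UNIV g" and supp: "\<forall>x. x \<notin> {-a..a} \<longrightarrow> g x = 0"
  shows "(averaged_fourier W g has_vector_derivative
    averaged_fourier (\<lambda>t. t * W t) (\<lambda>x. - \<i> * of_real x * g x) \<xi>) (at \<xi>)"
  unfolding averaged_fourier_def
proof (rule has_vector_derivative_lebesgue_integral
    [where B = "\<lambda>t. norm (t * W t) * (LINT x|lborel. norm (- \<i> * of_real x * g x))"])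
  have cont': "continuous_on UNIV (\<lambda>x. - \<i> * of_real x * g x)"
    by (intro continuous_intros cont)
  have supp': "\<forall>x. x \<notin> {-a..a} \<longrightarrow> - \<i> * of_real x * g x = 0"
    using supp by simp
  show "integrable lborel (\<lambda>t. of_real (W t) * fourier g (s * t))" for s
    by (rule integrable_averaged[OF W(1) cont supp])
  show "(\<lambda>t. of_real (t * W t) * fourier (\<lambda>x. - \<i> * of_real x * g x) (\<xi> * t)) \<in> borel_measurable lborel"
    by (rule borel_measurable_integrable[OF integrable_averaged[OF W(2) cont' supp']])
  show "integrable lborel (\<lambda>t. norm (t * W t) * (LINT x|lborel. norm (- \<i> * of_real x * g x)))"
    using integrable_norm[OF W(2)] by (rule integrable_mult_left)
  show "norm (of_real (t * W t) * fourier (\<lambda>x. - \<i> * of_real x * g x) (s * t))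
      \<le> norm (t * W t) * (LINT x|lborel. norm (- \<i> * of_real x * g x))" for s t
    unfolding norm_mult[of "of_real _"] norm_of_real real_norm_def
    by (intro mult_left_mono norm_fourier_le) auto
  show "((\<lambda>s. of_real (W t) * fourier g (s * t)) has_vector_derivative
      of_real (t * W t) * fourier (\<lambda>x. - \<i> * of_real x * g x) (s * t)) (at s)" for s t
  proof -
    have "((\<lambda>s. s * t) has_vector_derivative t) (at s)"
      by (auto intro!: derivative_eq_intros simp: has_vector_derivative_def)
    from vector_diff_chain_at[OF this has_vector_derivative_fourier_compact[OF cont supp]]
    have "((\<lambda>s. fourier g (s * t)) has_vector_derivative
        t *\<^sub>R fourier (\<lambda>x. - \<i> * of_real x * g x) (s * t)) (at s)"
      by (simp add: comp_def)
    from has_vector_derivative_mult_right[OF this, of "of_real (W t)"]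
    show ?thesis by (simp add: scaleR_conv_of_real mult_ac)
  qed
qed

text \<open>On \<open>{0..1}\<close> the powers of \<open>t\<close> are at most 1, so
  \<open>W\<close> itself is a majorant.\<close>

lemma integrable_moment:
  assumes W: "integrable lborel W" and supp: "\<forall>t. t \<notin> {0..1} \<longrightarrow> W t = 0"
  shows "integrable lborel (\<lambda>t. t ^ k * W t :: real)"
proof (rule Bochner_Integration.integrable_bound[OF W])
  have [measurable]: "W \<in> borel_measurable borel"
    using W by auto
  show "(\<lambda>t. t ^ k * W t) \<in> borel_measurable lborel" by measurable
  have "norm (t ^ k * W t) \<le> norm (W t)" for t
    using supp by (cases "t \<in> {0..1}") (auto simp: abs_mult power_le_one intro!: mult_left_le_one_le)
  then show "AE t in lborel. norm (t ^ k * W t) \<le> norm (W t)" by simp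
qed

text \<open>The closed form \<open>G k\<close> is differentiated for every order first. This
  supplies genuine derivatives, so the induction on \<open>nth_deriv\<close> never meets an
  arbitrary value of the total operator \<open>vector_derivative\<close>.\<close>

lemma averaged_fourier_higher_deriv:
  assumes W: "integrable lborel W" "\<forall>t. t \<notin> {0..1} \<longrightarrow> W t = 0"
    and cont: "continuous_on UNIV g" and supp: "\<forall>x. x \<notin> {-a..a} \<longrightarrow> g x = 0"
  defines "G \<equiv> \<lambda>k. averaged_fourier (\<lambda>t. t ^ k * W t) (\<lambda>x. (- \<i> * of_real x) ^ k * g x)"
  shows "(G k has_vector_derivative G (Suc k) \<xi>) (at \<xi>)"
    and "nth_deriv k (averaged_fourier W g) = G k"
    and "(G k \<longlongrightarrow> 0) at_infinity"
proof -
  have cont': "continuous_on UNIV (\<lambda>x. (- \<i> * of_real x) ^ k * g x)" for k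
    by (intro continuous_intros cont)
  have supp': "\<forall>x. x \<notin> {-a..a} \<longrightarrow> (- \<i> * of_real x) ^ k * g x = 0" for k
    using supp by simp
  note int = integrable_moment[OF W]
  show deriv: "(G k has_vector_derivative G (Suc k) \<xi>) (at \<xi>)" for k \<xi>
    using averaged_fourier_deriv[OF int _ cont' supp', of k] int[of "Suc k"]
    by (simp add: G_def mult.assoc)
  show "(G k \<longlongrightarrow> 0) at_infinity"
    unfolding G_def by (rule averaged_fourier_tendsto_0[OF int cont' supp'])
  show "nth_deriv k (averaged_fourier W g) = G k"
  proof (induction k)
    case 0
    then show ?case by (simp add: nth_deriv_def G_def)
  next
    case (Suc k)
    have "nth_deriv (Suc k) (averaged_fourier W g) = (\<lambda>\<xi>. vector_derivative (G k) (at \<xi>))"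
      using Suc by (simp add: nth_deriv_def)
    then show ?case
      using vector_derivative_at[OF deriv] by auto
  qed
qed

text \<open>Continuity of the derivative of order \<open>n\<close> comes from the existence of the
  next one, its decay from Riemann-Lebesgue.\<close>

lemma averaged_fourier_C_zero:
  assumes W: "integrable lborel W" "\<forall>t. t \<notin> {0..1} \<longrightarrow> W t = 0"
    and cont: "continuous_on UNIV g" and supp: "\<forall>x. x \<notin> {-a..a} \<longrightarrow> g x = 0"
  shows "times_differentiable n (averaged_fourier W g)"
    and "nth_deriv n (averaged_fourier W g) \<in> C_zero"
proof -
  let ?G = "\<lambda>k. averaged_fourier (\<lambda>t. t ^ k * W t) (\<lambda>x. (- \<i> * of_real x) ^ k * g x)"
  have deriv: "(?G k has_vector_derivative ?G (Suc k) \<xi>) (at \<xi>)"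
    and nth: "nth_deriv k (averaged_fourier W g) = ?G k"
    and lim: "(?G k \<longlongrightarrow> 0) at_infinity" for k \<xi>
    by (rule averaged_fourier_higher_deriv[OF W cont supp])+
  show "times_differentiable n (averaged_fourier W g)"
    unfolding times_differentiable_def nth differentiable_on_def
    by (intro allI impI ballI differentiableI_vector[OF deriv])
  show "nth_deriv n (averaged_fourier W g) \<in> C_zero"
    unfolding C_zero_def nth using lim
    by (intro CollectI conjI continuous_at_imp_continuous_on ballI
        has_vector_derivative_continuous[OF deriv])
qed

section \<open>The Bessel-Struve transform as an average over dilations\<close>

text \<open>Factor \<open>1 - t\<^sup>2\<close> as \<open>(1 + t) * (1 - t)\<close>. The power of
  \<open>1 + t\<close> is bounded on the interval, and that of \<open>1 - t\<close> is a Beta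
  integrand with parameters 1 and \<open>\<alpha> + 1/2\<close>, the latter positive by
  assumption.\<close>

lemma integrable_kernel_weight:
  assumes "\<alpha> > -1/2"
  shows "integrable lborel (\<lambda>t::real. indicator {0..1} t * (1 - t\<^sup>2) powr (\<alpha> - 1/2))"
proof -
  \<comment> \<open>As \<open>1 + t\<close> runs from 1 to 2, its power is largest at 2 for a
    nonnegative exponent and at 1 for a negative one; \<open>K\<close> covers both cases.\<close>
  define K where "K = max 1 (2 powr (\<alpha> - 1/2))"
  have "set_integrable lborel {0..1} (\<lambda>t::real. t powr (1 - 1) * (1 - t) powr ((\<alpha> + 1/2) - 1))"
    using assms by (intro integrable_Beta) auto
  then have "integrable lborel (\<lambda>t. K * (indicator {0..1} t *\<^sub>R (t powr (1 - 1) * (1 - t) powr ((\<alpha> + 1/2) - 1))))"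
    unfolding set_integrable_def by (rule integrable_mult_right)
  then show ?thesis
  proof (rule Bochner_Integration.integrable_bound)
    show "AE t in lborel. norm (indicator {0..1} t * (1 - t\<^sup>2) powr (\<alpha> - 1/2))
      \<le> norm (K * (indicator {0..1} t *\<^sub>R (t powr (1 - 1) * (1 - t) powr ((\<alpha> + 1/2) - 1))))"
      \<comment> \<open>the bound fails at \<open>t = 0\<close>, where \<open>t powr 0 = 0\<close>\<close>
      using AE_lborel_singleton[of 0]
    proof eventually_elim
      case (elim t)
      show ?case
      proof (cases "t \<in> {0..1}")
        case True
        have "(1 + t) powr (\<alpha> - 1/2) \<le> K"
        proof (cases "\<alpha> \<ge> 1/2")
          case True
          then have "(1 + t) powr (\<alpha> - 1/2) \<le> 2 powr (\<alpha> - 1/2)"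
            using \<open>t \<in> {0..1}\<close> by (intro powr_mono2) auto
          then show ?thesis by (simp add: K_def)
        next
          case False
          then have "(1 + t) powr (\<alpha> - 1/2) \<le> 1 powr (\<alpha> - 1/2)"
            using \<open>t \<in> {0..1}\<close> by (intro powr_mono2') auto
          then show ?thesis by (simp add: K_def)
        qed
        moreover have "(1 - t\<^sup>2) powr (\<alpha> - 1/2) = (1 + t) powr (\<alpha> - 1/2) * (1 - t) powr (\<alpha> - 1/2)"
          using True by (subst powr_mult[symmetric]) (auto simp: algebra_simps power2_eq_square)
        moreover have "K \<ge> 0" by (simp add: K_def)
        ultimately show ?thesis
          using True elim by (simp add: abs_mult mult_right_mono)
      qed simp
    qed
  qed measurable
qed

lemma bessel_struve_transform_eq_averaged_fourier:
  fixes f :: "real \<Rightarrow> complex" and \<alpha> :: real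
  defines "g \<equiv> \<lambda>x. f x * of_real (\<bar>x\<bar> powr (2 * \<alpha> + 1))"
  defines "w \<equiv> \<lambda>t. indicator {0..1} t * (1 - t\<^sup>2) powr (\<alpha> - 1/2)"
  assumes g: "integrable lborel g" and \<alpha>: "\<alpha> > -1/2"
  shows "bessel_struve_transform \<alpha> f =
    averaged_fourier (\<lambda>t. 2 * Gamma (\<alpha> + 1) / (sqrt pi * Gamma (\<alpha> + 1/2)) * w t) g"
proof
  fix \<xi> :: real
  define C where "C = 2 * Gamma (\<alpha> + 1) / (sqrt pi * Gamma (\<alpha> + 1/2))"
  \<comment> \<open>For fixed \<open>t\<close> the integral over \<open>x\<close> is a transform at
    frequency \<open>\<xi> * t\<close>; for fixed \<open>x\<close> the integral over
    \<open>t\<close> is the kernel at \<open>x\<close> times the remaining factors.\<close>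
  define \<phi> where "\<phi> x t = of_real (C * w t) * (g x * cis (- (\<xi> * t * x)))" for x t
  have w: "integrable lborel w"
    unfolding w_def by (rule integrable_kernel_weight[OF \<alpha>])
  have meas [measurable]: "w \<in> borel_measurable borel" "g \<in> borel_measurable borel"
    using w g by auto
  have cis [measurable]: "cis \<in> borel_measurable borel"
    by (intro borel_measurable_continuous_onI continuous_intros)
  have \<phi>_int: "integrable (lborel \<Otimes>\<^sub>M lborel) (case_prod \<phi>)"
  proof (rule lborel_pair.Fubini_integrable)
    show "case_prod \<phi> \<in> borel_measurable (lborel \<Otimes>\<^sub>M lborel)"
      unfolding \<phi>_def by measurable
    \<comment> \<open>The oscillating factor has modulus 1, so the norm of \<open>\<phi>\<close>
      splits into a function of \<open>x\<close> times a function of \<open>t\<close>, both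
      integrable.\<close>
    have "(LINT t|lborel. norm (\<phi> x t)) = norm (g x) * (LINT t|lborel. \<bar>C * w t\<bar>)" for x
      by (simp add: \<phi>_def norm_mult abs_mult mult_ac flip: integral_mult_right_zero)
    then show "integrable lborel (\<lambda>x. LINT t|lborel. norm (case_prod \<phi> (x, t)))"
      using g by simp
    show "AE x in lborel. integrable lborel (\<lambda>t. case_prod \<phi> (x, t))"
    proof (rule AE_I2)
      fix x
      have "integrable lborel (\<lambda>t. of_real (C * w t) * g x * cis (- (\<xi> * t * x)))"
        using w by (intro integrable_mult_cis integrable_mult_left integrable_of_real integrable_mult_right) auto
      then show "integrable lborel (\<lambda>t. case_prod \<phi> (x, t))"
        by (simp add: \<phi>_def mult.assoc)
    qed
  qed
  have "bessel_struve_transform \<alpha> f \<xi> = (LINT x|lborel. LINT t|lborel. \<phi> x t)"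
    unfolding bessel_struve_transform_def
  proof (rule Bochner_Integration.integral_cong[OF refl])
    fix x
    have exp: "exp (- \<i> * of_real \<xi> * of_real x * of_real t) = cis (- (\<xi> * t * x))" for t
      by (simp add: cis_conv_exp mult_ac)
    have "f x * bessel_struve_kernel \<alpha> (- \<i> * of_real \<xi>) x * of_real (\<bar>x\<bar> powr (2 * \<alpha> + 1)) =
      of_real C * g x * (LINT t|lborel. of_real (w t) * cis (- (\<xi> * t * x)))"
      unfolding bessel_struve_kernel_def C_def[symmetric] set_lebesgue_integral_def exp
      by (simp add: g_def w_def scaleR_conv_of_real mult_ac)
    also have "\<dots> = (LINT t|lborel. \<phi> x t)"
      by (simp add: \<phi>_def mult_ac flip: integral_mult_right_zero)
    finally show "f x * bessel_struve_kernel \<alpha> (- \<i> * of_real \<xi>) x * of_real (\<bar>x\<bar> powr (2 * \<alpha> + 1)) =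
      (LINT t|lborel. \<phi> x t)" .
  qed
  also have "\<dots> = (LINT t|lborel. LINT x|lborel. \<phi> x t)"
    using lborel_pair.Fubini_integral[OF \<phi>_int] by simp
  also have "\<dots> = averaged_fourier (\<lambda>t. C * w t) g \<xi>"
    unfolding \<phi>_def averaged_fourier_def fourier_def by (simp only: integral_mult_right_zero)
  finally show "bessel_struve_transform \<alpha> f \<xi> =
    averaged_fourier (\<lambda>t. 2 * Gamma (\<alpha> + 1) / (sqrt pi * Gamma (\<alpha> + 1/2)) * w t) g \<xi>"
    unfolding C_def .
qed

theorem proposition4p2:
  fixes \<alpha> a :: real and f :: "real \<Rightarrow> complex" and n :: nat
  assumes "\<alpha> > -1/2" and "a > 0" and "f \<in> test_functions a"
  shows "times_differentiable n (bessel_struve_transform \<alpha> f) \<and>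
    nth_deriv n (bessel_struve_transform \<alpha> f) \<in> C_zero"
proof -
  define g where "g = (\<lambda>x. f x * of_real (\<bar>x\<bar> powr (2 * \<alpha> + 1)))"
  have "times_differentiable 1 f"
    using assms(3) by (simp add: test_functions_def)
  then have "continuous_on UNIV f"
    by (auto simp: times_differentiable_def nth_deriv_def intro: differentiable_imp_continuous_on)
  \<comment> \<open>The lower bound on \<open>\<alpha>\<close> makes the exponent
    \<open>2 * \<alpha> + 1\<close> positive, which gives continuity of the power of
    \<open>\<bar>x\<bar>\<close> at the origin.\<close>
  then have cont: "continuous_on UNIV g"
    unfolding g_def using assms(1) by (intro continuous_intros continuous_on_powr') auto
  have "support_on UNIV f \<subseteq> {-a..a}"
    using assms(3) closure_subset by (fastforce simp: test_functions_def)
  then have supp: "\<forall>x. x \<notin> {-a..a} \<longrightarrow> g x = 0"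
    by (auto simp: g_def support_on_def)
  let ?W = "\<lambda>t. 2 * Gamma (\<alpha> + 1) / (sqrt pi * Gamma (\<alpha> + 1/2)) *
    (indicator {0..1} t * (1 - t\<^sup>2) powr (\<alpha> - 1/2))"
  have "integrable lborel ?W"
    by (intro integrable_mult_right integrable_kernel_weight assms)
  moreover have "\<forall>t. t \<notin> {0..1} \<longrightarrow> ?W t = 0" by simp
  moreover have "bessel_struve_transform \<alpha> f = averaged_fourier ?W g"
    using bessel_struve_transform_eq_averaged_fourier[of f \<alpha>]
      integrable_compact_support[OF cont supp] assms(1) by (simp add: g_def)
  ultimately show ?thesis
    using averaged_fourier_C_zero[OF _ _ cont supp, of ?W n] by simp
qed

end
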